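(* Let $A(x),B(x)\in\mathbb{Z}[x]$ be polynomials with nonzero leading coefficients which are coprime in $\mathbb{Q}[x]$, let $\Delta$ be their resultant, and let $G(n)=\gcd(A(n),B(n))$ for $n\in\mathbb{Z}$. For a prime $p$, write $\underline{\mathrm{m}}_p(n)=G(n)\wedge p^\infty$ (the largest power of $p$ dividing $G(n)$). Then: (1) for every prime $p$, the sequence $(\underline{\mathrm{m}}_p(n))_{n\in\mathbb{Z}}$ is periodic, with a period dividing $p^{\omega_p}$, where $\omega_p=\nu_p(\Delta)$; (2) for all $n\in\mathbb{Z}$, $G(n)=\prod_{p\mid\Delta}\underline{\mathrm{m}}_p(n)$, the product being over the primes dividing $\Delta$; (3) the sequence $(G(n))_{n\in\mathbb{Z}}$ is periodic, with a period dividing $\Delta$; (4) $\{G(n): n\in\mathbb{Z}\}=\Big\{\prod_{p\mid\Delta} m_p \;:\; m_p\in\{\underline{\mathrm{m}}_p(n):n\in\mathbb{Z}\}\text{ for each prime }p\mid\Delta\Big\}$, i.e. every choice of one value of each $\underline{\mathrm{m}}_p$ (with possibly different arguments for different primes) is realized as a product by some single value $G(n)$, and conversely.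
   Context: For $A(x)=a_dx^d+\cdots+a_0$ and $B(x)=b_ex^e+\cdots+b_0$ with $a_d\neq0$, $b_e\neq0$, the resultant $\Delta$ is the determinant of the $(d+e)\times(d+e)$ Sylvester matrix, whose first $e$ columns contain the coefficients $a_d,\dots,a_0$ shifted down by one row in each successive column, and whose last $d$ columns contain $b_e,\dots,b_0$ shifted down by one row in each successive column. For an integer $N$, $\nu_p(N)$ is the $p$-adic valuation of $N$ and $N\wedge p^\infty=p^{\nu_p(N)}$.
   Formalization: The formal statement assumes in addition that A and B are not both constant; for A = B = 2 the Sylvester matrix is empty, Δ = 1 and G(n) = 2, so (2) and (4) fail as stated. *)

theory Defs
  imports
    "HOL-Computational_Algebra.Computational_Algebra"
    "Subresultants.Resultant_Prelim"
begin

text \<open>The library Sylvester matrix carries the shifted coefficient vectors in its rows; the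
  mathematical convention here puts them in the columns. The determinant is the same.\<close>

lemma resultant_eq_det_column_sylvester:
  fixes A B :: "'a :: comm_ring_1 poly"
  defines "d \<equiv> degree A" and "e \<equiv> degree B"
  shows "resultant A B = det (mat (d + e) (d + e) (\<lambda>(i, j).
    if j < e then (if j \<le> i \<and> i \<le> j + d then coeff A (d - (i - j)) else 0)
    else (if j - e \<le> i \<and> i \<le> (j - e) + e then coeff B (e - (i - (j - e))) else 0)))"
    (is "_ = det ?M")
proof -
  have "?M = transpose_mat (sylvester_mat A B)"
    by (rule eq_matI)
      (auto simp: sylvester_index_mat d_def e_def intro!: arg_cong[where f = "coeff A"]
        arg_cong[where f = "coeff B"])
  then show ?thesis
    unfolding resultant_def using det_transpose[OF sylvester_carrier_mat[of A B]] by simp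
qed

definition poly_gcd_value :: "int poly \<Rightarrow> int poly \<Rightarrow> int \<Rightarrow> int" where
  "poly_gcd_value A B n = gcd (poly A n) (poly B n)"

text \<open>For \<open>N = 0\<close>, where the largest power of \<open>p\<close> dividing \<open>N\<close> does not exist, the value is 1.\<close>

definition prime_part :: "int \<Rightarrow> int \<Rightarrow> int" where
  "prime_part p N = p ^ multiplicity p N"

definition is_period :: "(int \<Rightarrow> 'a) \<Rightarrow> int \<Rightarrow> bool" where
  "is_period f T \<longleftrightarrow> T > 0 \<and> (\<forall>n. f (n + T) = f n)"

end

theory Submission
  imports Defs "Subresultants.Subresultant_Gcd" "HOL-Number_Theory.Cong"
begin

text \<open>The resultant lies in the ideal generated by \<open>A\<close> and \<open>B\<close>, so \<open>G n\<close> divides \<open>\<Delta>\<close> for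
  every \<open>n\<close>, and \<open>\<Delta>\<close> is nonzero by coprimality. A power \<open>p ^ k\<close> dividing \<open>G n\<close> thus satisfies
  \<open>k \<le> \<nu>\<^sub>p(\<Delta>)\<close>, so divisibility of \<open>G n\<close> by \<open>p ^ k\<close> depends only on \<open>n\<close> modulo
  \<open>p ^ \<nu>\<^sub>p(\<Delta>)\<close>. The Chinese remainder theorem then combines independent choices of arguments
  for the different primes into a single one.\<close>

text \<open>Adding \<open>x^(n-1-i)\<close> times row \<open>i\<close> of the column Sylvester
  matrix to its last row, for each \<open>i < n - 1\<close> with
  \<open>n = degree A + degree B\<close>, keeps the determinant and turns the last row into shifted
  copies of \<open>A\<close> and \<open>B\<close>; that is \<open>subresultant_mat 0 A B\<close>.
  Expansion along this row gives \<open>U\<close> and \<open>V\<close>. The degree bound makes the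
  row exist: for two constants the resultant is the empty determinant 1.\<close>

lemma resultant_in_ideal:
  fixes A B :: "'a :: idom poly"
  assumes "degree A + degree B \<ge> 1"
  shows "\<exists>U V. [:resultant A B:] = U * A + V * B"
proof -
  let ?n = "degree A + degree B"
  let ?M = "subresultant_mat 0 A B"
  let ?C = "\<lambda>j. cofactor ?M (?n - 1) j"
  let ?U = "\<Sum>j<?n. if j < degree B then monom 1 (degree B - 1 - j) * ?C j else 0"
  let ?V = "\<Sum>j<?n. if j < degree B then 0 else monom 1 (degree A - 1 - (j - degree B)) * ?C j"
  have M: "?M \<in> carrier_mat ?n ?n"
    by (rule carrier_matI) simp_all
  have entry: "?M $$ (?n - 1, j) = (if j < degree B then monom 1 (degree B - 1 - j) * A
      else monom 1 (degree A - 1 - (j - degree B)) * B)" if "j < ?n" for j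
    using that assms subresultant_index_mat[of "?n - 1" A 0 B j] by (simp add: Let_def)
  have "[:resultant A B:] = det ?M"
    using subresultant_resultant[of A B] by (simp add: subresultant_def)
  also have "\<dots> = (\<Sum>j<?n. ?M $$ (?n - 1, j) * ?C j)"
    by (rule laplace_expansion_row[OF M]) (use assms in auto)
  also have "\<dots> = ?U * A + ?V * B"
    by (simp only: sum_distrib_right flip: sum.distrib)
      (rule sum.cong[OF refl], simp only: entry lessThan_iff, simp add: ac_simps)
  finally show ?thesis by blast
qed

lemma poly_gcd_value_dvd_resultant:
  assumes "degree A + degree B \<ge> 1"
  shows "poly_gcd_value A B n dvd resultant A B"
proof -
  obtain U V where "[:resultant A B:] = U * A + V * B"
    using resultant_in_ideal[OF assms] by blast
  then have "resultant A B = poly U n * poly A n + poly V n * poly B n"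
    by (metis poly_add poly_const_conv poly_mult)
  then show ?thesis
    by (simp add: poly_gcd_value_def)
qed

text \<open>A common divisor over the integers stays one over the rationals, hence becomes a unit
  there. The integral gcd may still be a nonunit constant, but the resultant vanishes only if its
  degree is positive.\<close>

lemma resultant_nonzero_if_coprime_rat:
  fixes A B :: "int poly"
  assumes "coprime (map_poly rat_of_int A) (map_poly rat_of_int B)"
  shows "resultant A B \<noteq> 0"
proof -
  have "map_poly rat_of_int (gcd A B) dvd map_poly rat_of_int A"
    "map_poly rat_of_int (gcd A B) dvd map_poly rat_of_int B"
    by (auto elim!: dvdE simp: of_int_poly_hom.hom_mult intro: of_int_poly_hom.hom_dvd)
  then have "is_unit (map_poly rat_of_int (gcd A B))"
    using assms by (meson coprime_common_divisor)
  then have "degree (gcd A B) = 0"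
    by (metis is_unit_iff_degree of_int_hom.degree_map_poly_hom not_is_unit_0)
  then show ?thesis
    by (simp add: resultant_0_gcd)
qed

lemma cong_poly:
  fixes x y k :: "'a :: unique_euclidean_ring"
  assumes "[x = y] (mod k)"
  shows "[poly p x = poly p y] (mod k)"
  by (induction p) (auto intro!: cong_add cong_mult assms)

lemma power_dvd_poly_gcd_value_cong:
  fixes p x y D :: int
  assumes "D \<noteq> 0" and "prime p" and "poly_gcd_value A B x dvd D"
    and "[x = y] (mod p ^ multiplicity p D)"
    and "p ^ k dvd poly_gcd_value A B x"
  shows "p ^ k dvd poly_gcd_value A B y"
proof -
  have "k \<le> multiplicity p D"
    using assms by (intro multiplicity_geI) (auto intro: dvd_trans)
  then have "[x = y] (mod p ^ k)"
    using assms(4) by (meson cong_dvd_modulus le_imp_power_dvd)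
  then have "[poly A x = poly A y] (mod p ^ k)" "[poly B x = poly B y] (mod p ^ k)"
    by (auto intro: cong_poly)
  then show ?thesis
    using assms(5) by (auto simp: poly_gcd_value_def cong_dvd_iff)
qed

lemma prime_part_poly_gcd_value_cong:
  fixes p x y D :: int
  assumes "D \<noteq> 0" and "prime p" and "\<And>n. poly_gcd_value A B n dvd D"
    and "[x = y] (mod p ^ multiplicity p D)"
  shows "prime_part p (poly_gcd_value A B x) = prime_part p (poly_gcd_value A B y)"
proof -
  \<comment> \<open>One inequality suffices, since congruence is symmetric and \<open>u\<close>,
    \<open>v\<close> can be swapped.\<close>
  have le: "multiplicity p (poly_gcd_value A B u) \<le> multiplicity p (poly_gcd_value A B v)"
    if "[u = v] (mod p ^ multiplicity p D)" for u v
  proof (rule multiplicity_geI)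
    \<comment> \<open>A zero value would have multiplicity 0 by convention; it is excluded because
      the value divides \<open>D\<close>.\<close>
    show "poly_gcd_value A B v \<noteq> 0" "\<not> is_unit p"
      using assms(1-3) by (metis dvd_0_left, auto)
    show "p ^ multiplicity p (poly_gcd_value A B u) dvd poly_gcd_value A B v"
      by (rule power_dvd_poly_gcd_value_cong[OF assms(1-3) that multiplicity_dvd])
  qed
  from le[OF assms(4)] le[OF cong_sym[OF assms(4)]] show ?thesis
    by (simp add: prime_part_def)
qed

text \<open>This is the factorization of \<open>N\<close>, with index set enlarged to the primes of
  \<open>D\<close>: a prime not dividing \<open>N\<close> contributes the factor 1.\<close>

lemma prod_prime_part:
  fixes D N :: int
  assumes "D \<noteq> 0" and "N dvd D" and "N > 0"
  shows "(\<Prod>p | prime p \<and> p dvd D. prime_part p N) = N"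
proof -
  have "(\<Prod>p | prime p \<and> p dvd D. prime_part p N) = (\<Prod>p\<in>prime_factors N. prime_part p N)"
  proof (rule prod.mono_neutral_right)
    show "finite {p. prime p \<and> p dvd D}"
      using assms(1) by (rule finite_prime_divisors)
    show "prime_factors N \<subseteq> {p. prime p \<and> p dvd D}"
      using assms(2) by (auto simp: prime_factors_dvd intro: dvd_trans)
    show "\<forall>p\<in>{p. prime p \<and> p dvd D} - prime_factors N. prime_part p N = 1"
      using assms(3)
      by (auto simp: prime_part_def prime_factors_dvd not_dvd_imp_multiplicity_0)
  qed
  also have "\<dots> = N"
    using prime_factorization_int[OF assms(3)] by (simp add: prime_part_def)
  finally show ?thesis .
qed

text \<open>Each new modulus is coprime to the product of the earlier ones, so the case of two
  moduli merges it with the solution found so far.\<close>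

lemma chinese_remainder_int:
  fixes k u :: "'a \<Rightarrow> int"
  assumes "finite I"
    and "\<And>i j. i \<in> I \<Longrightarrow> j \<in> I \<Longrightarrow> i \<noteq> j \<Longrightarrow> coprime (k i) (k j)"
  shows "\<exists>x. \<forall>i\<in>I. [x = u i] (mod k i)"
  using assms
proof (induction I rule: finite_induct)
  case (insert q I)
  then obtain y where y: "\<forall>i\<in>I. [y = u i] (mod k i)"
    by blast
  have "coprime (k q) (\<Prod>i\<in>I. k i)"
    using insert.hyps insert.prems by (intro prod_coprime_right) auto
  then obtain x where x: "[x = u q] (mod k q)" "[x = y] (mod (\<Prod>i\<in>I. k i))"
    using binary_chinese_remainder_int by blast
  have "[x = u i] (mod k i)" if "i \<in> I" for i
    using x(2) y that insert.hyps(1) by (meson cong_dvd_modulus cong_trans dvd_prodI)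
  with x(1) show ?case by blast
qed simp

theorem theorem5:
  fixes A B :: "int poly" and \<Delta> :: int and G :: "int \<Rightarrow> int" and m :: "int \<Rightarrow> int \<Rightarrow> int"
  defines "\<Delta> \<equiv> resultant A B"
    and "G \<equiv> poly_gcd_value A B"
    and "m \<equiv> (\<lambda>p n. prime_part p (G n))"
  assumes "A \<noteq> 0" and "B \<noteq> 0"
    and "degree A + degree B \<ge> 1"
    and "coprime (map_poly rat_of_int A) (map_poly rat_of_int B)"
  shows "(\<forall>p. prime p \<longrightarrow> (\<exists>T. is_period (m p) T \<and> T dvd p ^ multiplicity p \<Delta>))
    \<and> (\<forall>n. G n = (\<Prod>p | prime p \<and> p dvd \<Delta>. m p n))
    \<and> (\<exists>T. is_period G T \<and> T dvd \<Delta>)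
    \<and> range G = {(\<Prod>p | prime p \<and> p dvd \<Delta>. c p) | c :: int \<Rightarrow> int.
        \<forall>p. prime p \<and> p dvd \<Delta> \<longrightarrow> c p \<in> range (m p)}"
proof -
  have nz: "\<Delta> \<noteq> 0"
    unfolding \<Delta>_def using assms(7) by (rule resultant_nonzero_if_coprime_rat)
  have dvd: "G n dvd \<Delta>" for n
    unfolding G_def \<Delta>_def using assms(6) by (rule poly_gcd_value_dvd_resultant)
  have pos: "G n > 0" for n
    using dvd[of n] nz by (auto simp: G_def poly_gcd_value_def less_le)
  have m_cong: "m p x = m p y" if "prime p" "[x = y] (mod p ^ multiplicity p \<Delta>)" for p x y
    using prime_part_poly_gcd_value_cong[OF nz that(1) dvd[unfolded G_def] that(2)]
    by (simp add: m_def G_def)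
  have period: "is_period (m p) (p ^ multiplicity p \<Delta>)" if "prime p" for p
    unfolding is_period_def
  proof (intro conjI allI)
    show "p ^ multiplicity p \<Delta> > 0"
      using that by (simp add: prime_gt_0_int)
    show "m p (n + p ^ multiplicity p \<Delta>) = m p n" for n
      by (rule m_cong[OF that]) (simp add: cong_def)
  qed
  have prod: "G n = (\<Prod>p | prime p \<and> p dvd \<Delta>. m p n)" for n
    using prod_prime_part[OF nz dvd pos] by (simp add: m_def)
  \<comment> \<open>\<open>\<Delta>\<close> may be negative while a period must be positive, hence
    the absolute value. It is a multiple of every \<open>p ^ multiplicity p \<Delta>\<close>, so no
    factor of the product changes.\<close>
  have "G (n + \<bar>\<Delta>\<bar>) = G n" for n
    unfolding prod
  proof (rule prod.cong[OF refl])
    fix p :: int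
    assume "p \<in> {p. prime p \<and> p dvd \<Delta>}"
    moreover have "[n + \<bar>\<Delta>\<bar> = n] (mod p ^ multiplicity p \<Delta>)"
      by (simp add: cong_iff_dvd_diff multiplicity_dvd)
    ultimately show "m p (n + \<bar>\<Delta>\<bar>) = m p n"
      by (intro m_cong) auto
  qed
  then have period_G: "is_period G \<bar>\<Delta>\<bar>"
    using nz by (simp add: is_period_def)
  have realized: "(\<Prod>p | prime p \<and> p dvd \<Delta>. c p) \<in> range G"
    if c: "\<forall>p. prime p \<and> p dvd \<Delta> \<longrightarrow> c p \<in> range (m p)" for c
  proof -
    \<comment> \<open>\<open>u p\<close> is an argument at which \<open>m p\<close> takes the
      prescribed value; it may differ from prime to prime.\<close>
    obtain u where u: "\<And>p. prime p \<Longrightarrow> p dvd \<Delta> \<Longrightarrow> c p = m p (u p)"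
      using c unfolding image_iff by metis
    have "\<exists>x. \<forall>p\<in>{p. prime p \<and> p dvd \<Delta>}. [x = u p] (mod p ^ multiplicity p \<Delta>)"
      using nz by (intro chinese_remainder_int finite_prime_divisors)
        (auto intro!: primes_coprime)
    then obtain x where "\<And>p. prime p \<Longrightarrow> p dvd \<Delta> \<Longrightarrow> [x = u p] (mod p ^ multiplicity p \<Delta>)"
      by blast
    \<comment> \<open>By \<open>m_cong\<close>, \<open>m p x = m p (u p) = c p\<close> for all these
      primes at once.\<close>
    then have "(\<Prod>p | prime p \<and> p dvd \<Delta>. c p) = G x"
      unfolding prod by (intro prod.cong) (auto simp: u intro: m_cong[symmetric])
    then show ?thesis by blast
  qed
  show ?thesis
  proof (intro conjI allI impI)
    show "\<exists>T. is_period (m p) T \<and> T dvd p ^ multiplicity p \<Delta>" if "prime p" for p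
      using period[OF that] dvd_refl by blast
    show "G n = (\<Prod>p | prime p \<and> p dvd \<Delta>. m p n)" for n
      by (rule prod)
    show "\<exists>T. is_period G T \<and> T dvd \<Delta>"
      using period_G by (intro exI[of _ "\<bar>\<Delta>\<bar>"]) simp
    show "range G = {(\<Prod>p | prime p \<and> p dvd \<Delta>. c p) | c :: int \<Rightarrow> int.
        \<forall>p. prime p \<and> p dvd \<Delta> \<longrightarrow> c p \<in> range (m p)}"
    proof (intro equalityI subsetI)
      fix N
      assume "N \<in> range G"
      then obtain n where "N = (\<Prod>p | prime p \<and> p dvd \<Delta>. m p n)"
        using prod by auto
      then show "N \<in> {(\<Prod>p | prime p \<and> p dvd \<Delta>. c p) | c :: int \<Rightarrow> int.
          \<forall>p. prime p \<and> p dvd \<Delta> \<longrightarrow> c p \<in> range (m p)}"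
        \<comment> \<open>For the easy inclusion all primes share the same argument
          \<open>n\<close>.\<close>
        by (intro CollectI exI[of _ "\<lambda>p. m p n"]) auto
    qed (use realized in auto)
  qed
qed

end
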